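(* Let $V$ be a complete holomorphic vector field on $\mathbb{C}^n$ for which the origin is a globally asymptotically stable fixed point, let $A=DV(0)$, let $X_t$ denote the flow of $V$, and write $V(z)=Az+R(z)$, where $R(z)=o(\|z\|)$ as $z\to 0$. Suppose that, for every compact set $K\subset\mathbb{C}^n$, the improper integral $\int_0^\infty e^{-sA}R(X_s(z))\,ds$ converges uniformly for $z\in K$. Let $F\in\operatorname{Aut}(\mathbb{C}^n)$ be the linearizing automorphism $F(z)=\lim_{t\to\infty}e^{-tA}X_t(z)$, so that $F\circ X_t\circ F^{-1}=e^{tA}$. Then the following hold. (1) If $D\subset\mathbb{C}^n$ satisfies $e^{tA}(D)\subset D$ for all $t\ge 0$, then $\Omega:=F^{-1}(D)$ is a positive-time flow invariant domain for $V$. (2) If $J$ is a first integral of the linear flow, that is, $J(e^{tA}w)=J(w)$, then $I:=J\circ F$ is a first integral of the nonlinear flow: $I(X_t(z))=I(z)$.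
   Context: A holomorphic vector field on $\mathbb{C}^n$ is identified with a holomorphic map $V:\mathbb{C}^n\to\mathbb{C}^n$; its flow $X_t$ solves $\frac{d}{dt}X_t(z)=V(X_t(z))$, $X_0(z)=z$. Complete means that the flow is defined for all complex times; its restriction to $t\in\mathbb{R}$ is the real-time flow. The origin is a globally asymptotically stable (globally attracting) fixed point if $V(0)=0$ and $X_t(z)\to 0$ as $t\to\infty$ (real time) for every $z\in\mathbb{C}^n$. A domain $\Omega\subset\mathbb{C}^n$ is called positive-time flow invariant for $V$ if $X_t(\Omega)\subset\Omega$ for every $t\ge 0$. The linear flow is $w\mapsto e^{tA}w$, and the nonlinear flow is $X_t$. $\operatorname{Aut}(\mathbb{C}^n)$ is the group of biholomorphic maps $\mathbb{C}^n\to\mathbb{C}^n$. Under the stated hypotheses on $V$, the limit defining $F$ (over real $t\to\infty$) exists locally uniformly on $\mathbb{C}^n$, $F\in\operatorname{Aut}(\mathbb{C}^n)$, and $F\circ X_t\circ F^{-1}=e^{tA}$ for all $t\in\mathbb{C}$.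
   Formalization: In (1), flow invariance of Ω=F^{-1}(D) is stated for every D, but that Ω is a domain only when D is itself a domain (nonempty, open, connected); for arbitrary D, such as D={0}, the claim that Ω is a domain fails. *)

theory Defs
  imports "HOL-Analysis.Analysis"
begin

text \<open>
  Holomorphy in several variables is Frechet differentiability with a \<open>complex\<close>-linear derivative,
  i.e. one given by a complex Jacobian matrix (the library's \<open>has_derivative\<close> alone only
  provides a real-linear one).
\<close>

definition holomorphic_map :: "(complex ^ 'n \<Rightarrow> complex ^ 'm) \<Rightarrow> bool" where
  "holomorphic_map f \<longleftrightarrow>
     (\<forall>z. \<exists>M :: complex ^ 'n ^ 'm. (f has_derivative (\<lambda>h. M *v h)) (at z))"

definition holomorphic_automorphism :: "(complex ^ 'n \<Rightarrow> complex ^ 'n) \<Rightarrow> bool" where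
  "holomorphic_automorphism F \<longleftrightarrow> bij F \<and> holomorphic_map F \<and> holomorphic_map (inv F)"

text \<open>
  \<open>X\<close> is the flow of \<open>V\<close>, defined for all complex times: the derivative of \<open>s \<mapsto> X s z\<close> at \<open>t\<close> is
  the complex-linear map \<open>h \<mapsto> h V(X t z)\<close>. That such an \<open>X\<close> exists is exactly completeness of \<open>V\<close>;
  for holomorphic \<open>V\<close> it is unique.
\<close>

definition complex_flow ::
    "(complex ^ 'n \<Rightarrow> complex ^ 'n) \<Rightarrow> (complex \<Rightarrow> complex ^ 'n \<Rightarrow> complex ^ 'n) \<Rightarrow> bool" where
  "complex_flow V X \<longleftrightarrow>
     (\<forall>z. X 0 z = z) \<and>
     (\<forall>t z. ((\<lambda>s. X s z) has_derivative (\<lambda>h. h *s V (X t z))) (at t))"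

definition globally_attracting_origin ::
    "(complex ^ 'n \<Rightarrow> complex ^ 'n) \<Rightarrow> (complex \<Rightarrow> complex ^ 'n \<Rightarrow> complex ^ 'n) \<Rightarrow> bool" where
  "globally_attracting_origin V X \<longleftrightarrow>
     V 0 = 0 \<and> (\<forall>z. ((\<lambda>t::real. X (of_real t) z) \<longlongrightarrow> 0) at_top)"

text \<open>
  The exponential is the power series for the matrix product \<open>**\<close>; the multiplication \<open>*\<close> that the
  library defines on the type of vectors is entrywise, so its \<open>^\<close> cannot be used.
\<close>

primrec matrix_pow :: "complex ^ 'n ^ 'n \<Rightarrow> nat \<Rightarrow> complex ^ 'n ^ 'n" where
  "matrix_pow A 0 = mat 1"
| "matrix_pow A (Suc k) = A ** matrix_pow A k"

definition matrix_exp :: "complex ^ 'n ^ 'n \<Rightarrow> complex ^ 'n ^ 'n" where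
  "matrix_exp A = (\<Sum>k. matrix_pow A k /\<^sub>R fact k)"

text \<open>Here \<open>mat t ** A\<close> is the scalar multiple \<open>tA\<close>.\<close>

definition linear_flow :: "complex ^ 'n ^ 'n \<Rightarrow> complex \<Rightarrow> complex ^ 'n \<Rightarrow> complex ^ 'n" where
  "linear_flow A t w = matrix_exp (mat t ** A) *v w"

definition uniformly_convergent_improper_integral ::
    "(complex ^ 'n) set \<Rightarrow> (real \<Rightarrow> complex ^ 'n \<Rightarrow> complex ^ 'n) \<Rightarrow> bool" where
  "uniformly_convergent_improper_integral K f \<longleftrightarrow>
     (\<exists>g. uniform_limit K (\<lambda>T z. integral {0..T} (\<lambda>s. f s z)) g at_top)"

definition is_domain :: "(complex ^ 'n) set \<Rightarrow> bool" where
  "is_domain S \<longleftrightarrow> open S \<and> connected S \<and> S \<noteq> {}"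

definition positive_time_invariant ::
    "(complex \<Rightarrow> complex ^ 'n \<Rightarrow> complex ^ 'n) \<Rightarrow> (complex ^ 'n) set \<Rightarrow> bool" where
  "positive_time_invariant \<Phi> S \<longleftrightarrow> (\<forall>t::real. 0 \<le> t \<longrightarrow> \<Phi> (of_real t) ` S \<subseteq> S)"

text \<open>
  The set \<open>T\<close> of times is \<open>UNIV\<close> for the complex-time flow and \<open>\<real>\<close> for the real-time flow.
\<close>

definition first_integral ::
    "complex set \<Rightarrow> (complex \<Rightarrow> complex ^ 'n \<Rightarrow> complex ^ 'n) \<Rightarrow> (complex ^ 'n \<Rightarrow> 'b) \<Rightarrow> bool" where
  "first_integral T \<Phi> J \<longleftrightarrow> (\<forall>t\<in>T. \<forall>z. J (\<Phi> t z) = J z)"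

end

theory Submission
  imports Defs "HOL-Complex_Analysis.Cauchy_Integral_Formula"
begin

text \<open>
  Everything follows from the intertwining relation \<open>F (X t z) = e\<^sup>t\<^sup>A F z\<close> for all complex \<open>t\<close>: it
  carries the forward invariance of \<open>D\<close> and the invariance of \<open>J\<close> under the linear flow to \<open>F -` D\<close>
  and \<open>J \<circ> F\<close>, and \<open>F\<close>, being a homeomorphism, pulls domains back to domains.

  For real \<open>t\<close>, the group law of the two flows turns \<open>e\<^sup>-\<^sup>s\<^sup>A X s (X t z)\<close>, whose limit as
  \<open>s \<longlonglongrightarrow> \<infinity>\<close> is \<open>F (X t z)\<close>, into the image under \<open>e\<^sup>t\<^sup>A\<close> of \<open>e\<^sup>-\<^sup>u\<^sup>A X u z\<close> with \<open>u = s + t\<close>, whose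
  limit is \<open>e\<^sup>t\<^sup>A F z\<close>.
  Differentiating at \<open>t = 0\<close> gives \<open>DF(z) V(z) = A F(z)\<close>. The left-hand side is complex linear in the
  direction of time, so \<open>t \<mapsto> F (X t z)\<close> is, over the whole complex time plane, a trajectory of the
  linear field \<open>A\<close>, and it agrees with \<open>e\<^sup>t\<^sup>A F z\<close> by uniqueness of trajectories.

  Uniqueness (\<open>complex_trajectory_unique\<close>) serves three times: for the group law of each flow and for
  this last step. Along each ray of complex times it is Gronwall's argument, which needs a Lipschitz
  bound for a field that is only assumed complex differentiable at every point. The Cauchy estimate on
  complex lines supplies it: a bound of the field on a ball bounds its Jacobian on a smaller ball
  (\<open>holomorphic_map_Lipschitz_cball\<close>).
\<close>

section \<open>Derivatives of vector-valued maps\<close>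

lemma has_derivative_vecI:
  fixes f :: "'a::euclidean_space \<Rightarrow> ('b::real_normed_vector) ^ 'n"
  assumes "\<And>i. ((\<lambda>x. f x $ i) has_derivative (\<lambda>h. D h $ i)) (at a)"
  shows "(f has_derivative D) (at a)"
proof -
  have lin: "linear (\<lambda>h. D h $ i)" for i
    using assms[of i] has_derivative_linear by blast
  have "linear D"
    by (rule linearI)
       (simp_all add: vec_eq_iff linear_add[OF lin] linear_scale[OF lin])
  moreover have "((\<lambda>y. (f y - f a - D (y - a)) /\<^sub>R norm (y - a)) \<longlongrightarrow> 0) (at a)"
    by (rule vec_tendstoI) (use assms in \<open>simp add: has_derivative_at_within\<close>)
  ultimately show ?thesis
    by (simp add: has_derivative_at_within linear_conv_bounded_linear)
qed

lemma norm_scalar_mult_vec: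
  fixes v :: "complex ^ 'n"
  shows "norm (c *s v) = norm c * norm v"
  by (simp add: norm_vec_def norm_mult L2_set_right_distrib)

lemma has_derivative_scalar_mult_vec:
  fixes v :: "complex ^ 'n"
  shows "((\<lambda>s. s *s v) has_derivative (\<lambda>h. h *s v)) (at t)"
  by (rule has_derivative_vecI) (auto intro!: derivative_eq_intros)

lemma scalar_mat_mult_entry:
  fixes M :: "complex ^ 'n ^ 'm"
  shows "(mat c ** M) $ i $ j = c * M $ i $ j"
  by (simp add: matrix_matrix_mult_def mat_def if_distrib [where f = "\<lambda>x. x * _"] cong: if_cong)

lemma matrix_vector_mult_scalar_mat:
  fixes M :: "complex ^ 'n ^ 'm"
  shows "(mat c ** M) *v h = c *s (M *v h)"
  by (simp add: vec_eq_iff matrix_vector_mult_def scalar_mat_mult_entry sum_distrib_left mult.assoc)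

lemma holomorphic_map_scalar_mult:
  assumes "holomorphic_map V"
  shows "holomorphic_map (\<lambda>z. c *s V z)"
  unfolding holomorphic_map_def
proof
  fix z
  obtain M where M: "(V has_derivative (\<lambda>h. M *v h)) (at z)"
    using assms unfolding holomorphic_map_def by blast
  have "((\<lambda>z. c *s V z) has_derivative (\<lambda>h. (mat c ** M) *v h)) (at z)"
    unfolding matrix_vector_mult_scalar_mat
    by (rule has_derivative_vecI)
       (auto intro!: derivative_eq_intros bounded_linear.has_derivative[OF bounded_linear_vec_nth M])
  then show "\<exists>M. ((\<lambda>z. c *s V z) has_derivative (\<lambda>h. M *v h)) (at z)" by blast
qed

lemma holomorphic_map_matrix_vector_mult: "holomorphic_map (\<lambda>z. A *v z)"
  unfolding holomorphic_map_def
  using bounded_linear_imp_has_derivative[OF matrix_vector_mul_bounded_linear] by blast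

lemma holomorphic_map_continuous_on: "holomorphic_map f \<Longrightarrow> continuous_on S f"
  unfolding holomorphic_map_def
  by (meson continuous_at_imp_continuous_on has_derivative_continuous)

section \<open>Local Lipschitz continuity of holomorphic maps\<close>

text \<open>
  The map is restricted to the complex line through \<open>z\<close> in the direction \<open>h\<close>; on it, the directional
  derivative is an ordinary complex derivative, to which the Cauchy estimate applies.
\<close>

lemma holomorphic_map_jacobian_bound:
  fixes V :: "complex ^ 'n \<Rightarrow> complex ^ 'm"
  assumes V: "holomorphic_map V"
    and M: "(V has_derivative (\<lambda>h. M *v h)) (at z)"
    and h: "norm h \<le> 1"
    and bound: "\<And>w. w \<in> cball z 1 \<Longrightarrow> norm (V w) \<le> B"
  shows "norm ((M *v h) $ i) \<le> B"
proof -
  define \<phi> where "\<phi> = (\<lambda>\<zeta>. V (z + \<zeta> *s h) $ i)"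
  have line: "((\<lambda>\<zeta>. z + \<zeta> *s h) has_derivative (\<lambda>k. k *s h)) (at \<zeta>)" for \<zeta>
    using has_derivative_add[OF has_derivative_const has_derivative_scalar_mult_vec] by simp
  have deriv: "(\<phi> has_field_derivative (N *v h) $ i) (at \<zeta>)"
    if N: "(V has_derivative (\<lambda>h. N *v h)) (at (z + \<zeta> *s h))" for \<zeta> N
  proof -
    have "(\<phi> has_derivative (\<lambda>k. (N *v (k *s h)) $ i)) (at \<zeta>)"
      unfolding \<phi>_def
      by (rule bounded_linear.has_derivative[OF bounded_linear_vec_nth])
         (rule has_derivative_compose[OF line N])
    moreover have "(\<lambda>k. (N *v (k *s h)) $ i) = (*) ((N *v h) $ i)"
      by (simp add: vector_scalar_commute fun_eq_iff)
    ultimately show ?thesis by (simp add: has_field_derivative_def)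
  qed
  have hol: "\<phi> holomorphic_on S" for S
    using V deriv unfolding holomorphic_map_def
    by (metis field_differentiable_at_within field_differentiable_def holomorphic_on_def)
  have "norm ((deriv ^^ 1) \<phi> 0) \<le> fact 1 * B / 1 ^ 1"
  proof (rule Cauchy_inequality)
    fix \<zeta> :: complex
    assume "norm (0 - \<zeta>) = 1"
    then have "norm (\<zeta> *s h) \<le> 1"
      using h by (simp add: norm_scalar_mult_vec)
    then have "norm (V (z + \<zeta> *s h)) \<le> B"
      by (intro bound) (simp add: dist_norm)
    then show "norm (\<phi> \<zeta>) \<le> B"
      unfolding \<phi>_def using Finite_Cartesian_Product.norm_nth_le[of "V (z + \<zeta> *s h)" i] by linarith
  qed (use hol holomorphic_on_imp_continuous_on in auto)
  moreover have "deriv \<phi> 0 = (M *v h) $ i"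
    by (rule DERIV_imp_deriv, rule deriv) (use M in simp)
  ultimately show ?thesis by simp
qed

lemma holomorphic_map_Lipschitz_cball:
  fixes V :: "complex ^ 'n \<Rightarrow> complex ^ 'm"
  assumes V: "holomorphic_map V"
  obtains L where "\<And>x y. x \<in> cball 0 r \<Longrightarrow> y \<in> cball 0 r \<Longrightarrow> norm (V x - V y) \<le> L * norm (x - y)"
proof -
  have "compact (V ` cball 0 (r + 1))"
    by (intro compact_continuous_image holomorphic_map_continuous_on[OF V] compact_cball)
  then obtain B where B: "\<And>w. w \<in> cball 0 (r + 1) \<Longrightarrow> norm (V w) \<le> B"
    by (meson bounded_iff compact_imp_bounded image_eqI)
  obtain M where M: "\<And>z. (V has_derivative (\<lambda>h. M z *v h)) (at z)"
    using V unfolding holomorphic_map_def by metis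
  have "onorm (\<lambda>h. M z *v h) \<le> CARD('m) * B" if z: "z \<in> cball 0 r" for z
  proof (rule onorm_le)
    fix h :: "complex ^ 'n"
    have unit: "norm (M z *v u) \<le> CARD('m) * B" if u: "norm u \<le> 1" for u
    proof -
      have "norm ((M z *v u) $ i) \<le> B" for i
      proof (rule holomorphic_map_jacobian_bound[OF V M u])
        fix w assume "w \<in> cball z 1"
        then have "dist 0 w \<le> r + 1"
          using z dist_triangle[of 0 w z] by simp
        then show "norm (V w) \<le> B" by (intro B) simp
      qed
      then have "(\<Sum>i\<in>UNIV. norm ((M z *v u) $ i)) \<le> CARD('m) * B"
        by (intro sum_bounded_above) auto
      moreover have "norm (M z *v u) \<le> (\<Sum>i\<in>UNIV. norm ((M z *v u) $ i))"
        unfolding norm_vec_def by (rule L2_set_le_sum) simp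
      ultimately show ?thesis by linarith
    qed
    show "norm (M z *v h) \<le> CARD('m) * B * norm h"
    proof (cases "h = 0")
      case False
      have "M z *v (h /\<^sub>R norm h) = (M z *v h) /\<^sub>R norm h"
        by (rule linear_scale) (simp add: bounded_linear.linear)
      then show ?thesis
        using unit[of "h /\<^sub>R norm h"] False by (simp add: field_simps)
    qed simp
  qed
  then have "norm (V x - V y) \<le> (CARD('m) * B) * norm (x - y)"
    if "x \<in> cball 0 r" "y \<in> cball 0 r" for x y
    using M that
    by (intro differentiable_bound[OF convex_cball[of 0 r], where f' = "\<lambda>z h. M z *v h"])
       (auto intro: has_derivative_at_withinI)
  then show ?thesis using that by blast
qed

section \<open>Uniqueness of trajectories\<close>

lemma real_trajectory_unique:
  fixes x y :: "real \<Rightarrow> complex ^ 'n"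
  assumes V: "holomorphic_map V"
    and x: "\<And>u. (x has_vector_derivative V (x u)) (at u)"
    and y: "\<And>u. (y has_vector_derivative V (y u)) (at u)"
    and init: "x 0 = y 0"
    and "0 \<le> T"
  shows "x T = y T"
proof -
  have "continuous_on {0..T} x" "continuous_on {0..T} y"
    using x y
    by (auto intro!: continuous_at_imp_continuous_on has_vector_derivative_continuous)
  then have "bounded (x ` {0..T} \<union> y ` {0..T})"
    by (simp add: compact_imp_bounded compact_continuous_image)
  then obtain r where "\<And>w. w \<in> x ` {0..T} \<union> y ` {0..T} \<Longrightarrow> norm w \<le> r"
    by (meson bounded_iff)
  then have r: "x u \<in> cball 0 r" "y u \<in> cball 0 r" if "u \<in> {0..T}" for u
    using that by auto
  obtain L where
    L: "\<And>x y. x \<in> cball 0 r \<Longrightarrow> y \<in> cball 0 r \<Longrightarrow> norm (V x - V y) \<le> L * norm (x - y)"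
    using holomorphic_map_Lipschitz_cball[OF V] by blast
  \<comment> \<open>Gronwall: the squared distance, damped by the factor that the Lipschitz constant dictates,
      does not increase.\<close>
  define g where "g = (\<lambda>u. ((x u - y u) \<bullet> (x u - y u)) * exp (- 2 * L * u))"
  define g' where "g' = (\<lambda>u. (2 * ((x u - y u) \<bullet> (V (x u) - V (y u)))
      - 2 * L * ((x u - y u) \<bullet> (x u - y u))) * exp (- 2 * L * u))"
  have "(g has_field_derivative g' u) (at u)" for u
  proof -
    have "((\<lambda>u. x u - y u) has_vector_derivative (V (x u) - V (y u))) (at u)"
      by (intro has_vector_derivative_diff x y)
    then have d: "((\<lambda>u. x u - y u) has_derivative (\<lambda>h. h *\<^sub>R (V (x u) - V (y u)))) (at u)"
      by (simp add: has_vector_derivative_def)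
    have "((\<lambda>u. (x u - y u) \<bullet> (x u - y u)) has_field_derivative
             2 * ((x u - y u) \<bullet> (V (x u) - V (y u)))) (at u)"
      unfolding has_field_derivative_def
      by (rule has_derivative_eq_rhs[OF has_derivative_inner[OF d d]])
         (auto simp: fun_eq_iff inner_commute)
    moreover have "((\<lambda>u. exp (- 2 * L * u)) has_field_derivative - 2 * L * exp (- 2 * L * u)) (at u)"
      by (auto intro!: derivative_eq_intros)
    ultimately show ?thesis
      unfolding g_def g'_def
      by (rule DERIV_cong[OF DERIV_mult]) algebra
  qed
  moreover have "g' u \<le> 0" if "u \<in> {0..T}" for u
  proof -
    have "(x u - y u) \<bullet> (V (x u) - V (y u)) \<le> norm (x u - y u) * norm (V (x u) - V (y u))"
      by (rule norm_cauchy_schwarz)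
    also have "\<dots> \<le> norm (x u - y u) * (L * norm (x u - y u))"
      by (intro mult_left_mono L r that norm_ge_zero)
    also have "\<dots> = L * ((x u - y u) \<bullet> (x u - y u))"
      by (simp add: dot_square_norm power2_eq_square)
    finally show ?thesis
      unfolding g'_def by (intro mult_nonpos_nonneg) auto
  qed
  ultimately have "g T \<le> g 0"
    using \<open>0 \<le> T\<close> by (intro DERIV_nonpos_imp_nonincreasing[of 0 T g]) auto
  then have "(x T - y T) \<bullet> (x T - y T) \<le> 0"
    by (simp add: g_def init mult_le_0_iff)
  then show ?thesis
    by (metis antisym inner_eq_zero_iff inner_ge_zero right_minus_eq)
qed

text \<open>A solution, in complex time, of the differential equation given by \<open>V\<close>.\<close>

definition complex_trajectory ::
    "(complex ^ 'n \<Rightarrow> complex ^ 'n) \<Rightarrow> (complex \<Rightarrow> complex ^ 'n) \<Rightarrow> bool" where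
  "complex_trajectory V y \<longleftrightarrow> (\<forall>t. (y has_derivative (\<lambda>h. h *s V (y t))) (at t))"

text \<open>
  Along the ray through a complex time \<open>c\<close>, a trajectory solves a real differential equation, for the
  field \<open>cV\<close>.
\<close>

lemma complex_trajectory_ray:
  fixes y :: "complex \<Rightarrow> complex ^ 'n"
  assumes "complex_trajectory V y"
  shows "((\<lambda>u. y (of_real u * c)) has_vector_derivative c *s V (y (of_real u * c))) (at u)"
proof -
  have "((\<lambda>u::real. of_real u * c) has_derivative (\<lambda>h. of_real h * c)) (at u)"
    by (auto intro!: derivative_eq_intros)
  then have "((\<lambda>u. y (of_real u * c)) has_derivative
      (\<lambda>h. (of_real h * c) *s V (y (of_real u * c)))) (at u)"
    by (rule has_derivative_compose) (use assms in \<open>simp add: complex_trajectory_def\<close>)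
  moreover have "(of_real h * c) *s v = h *\<^sub>R (c *s v)" for h :: real and v :: "complex ^ 'n"
    by (simp add: vec_eq_iff scaleR_conv_of_real[where 'a = complex])
  ultimately show ?thesis by (simp add: has_vector_derivative_def)
qed

lemma complex_trajectory_unique:
  assumes V: "holomorphic_map V"
    and x: "complex_trajectory V x" and y: "complex_trajectory V y"
    and init: "x 0 = y 0"
  shows "x t = y t"
  using real_trajectory_unique[OF holomorphic_map_scalar_mult[OF V]
      complex_trajectory_ray[OF x, where c = t] complex_trajectory_ray[OF y, where c = t],
      where T = 1] init
  by simp

lemma complex_flow_trajectory: "complex_flow V X \<Longrightarrow> complex_trajectory V (\<lambda>t. X t z)"
  by (simp add: complex_flow_def complex_trajectory_def)

lemma complex_flow_add:
  assumes V: "holomorphic_map V" and X: "complex_flow V X"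
  shows "X (s + t) z = X s (X t z)"
proof (rule complex_trajectory_unique[OF V,
      where x = "\<lambda>s. X (s + t) z" and y = "\<lambda>s. X s (X t z)"])
  have shift: "((\<lambda>s. s + t) has_derivative (\<lambda>h. h)) (at s)" for s
    by (auto intro!: derivative_eq_intros)
  have "((\<lambda>s. X s z) has_derivative (\<lambda>h. h *s V (X t' z))) (at t')" for t'
    using X by (simp add: complex_flow_def)
  from has_derivative_compose[OF shift this]
  show "complex_trajectory V (\<lambda>s. X (s + t) z)"
    by (simp add: complex_trajectory_def)
  show "complex_trajectory V (\<lambda>s. X s (X t z))"
    using X by (rule complex_flow_trajectory)
  show "X (0 + t) z = X 0 (X t z)"
    using X by (simp add: complex_flow_def)
qed

section \<open>The linear flow\<close>

lemma matrix_pow_scalar_mult: "matrix_pow (mat t ** A) k $ i $ j = t ^ k * matrix_pow A k $ i $ j"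
proof (induction k arbitrary: i)
  case (Suc k)
  have "matrix_pow (mat t ** A) (Suc k) $ i $ j
      = (\<Sum>l\<in>UNIV. (t * A $ i $ l) * (t ^ k * matrix_pow A k $ l $ j))"
    unfolding matrix_pow.simps matrix_matrix_mult_def[of "mat t ** A"]
    by (simp add: scalar_mat_mult_entry Suc)
  then show ?case
    by (simp add: matrix_matrix_mult_def sum_distrib_left mult_ac)
qed (simp add: mat_def)

lemma matrix_pow_entry_bound:
  fixes A :: "complex ^ 'n ^ 'n"
  shows "\<exists>c. \<forall>k i j. norm (matrix_pow A k $ i $ j) \<le> c ^ k"
proof -
  have entry: "norm (A $ i $ j) \<le> norm A" for i j
    using Finite_Cartesian_Product.norm_nth_le[of A i]
      Finite_Cartesian_Product.norm_nth_le[of "A $ i" j] by linarith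
  have "norm (matrix_pow A k $ i $ j) \<le> (CARD('n) * norm A) ^ k" for k i j
  proof (induction k arbitrary: i)
    case (Suc k)
    have "norm (matrix_pow A (Suc k) $ i $ j) \<le> (\<Sum>l\<in>UNIV. norm (A $ i $ l * matrix_pow A k $ l $ j))"
      unfolding matrix_pow.simps matrix_matrix_mult_def by (simp add: norm_sum)
    also have "\<dots> \<le> (\<Sum>l\<in>(UNIV::'n set). norm A * (CARD('n) * norm A) ^ k)"
      unfolding norm_mult by (intro sum_mono mult_mono entry Suc) auto
    finally show ?case by (simp add: mult_ac)
  qed (simp add: mat_def)
  then show ?thesis by blast
qed

lemma summable_matrix_exp_entry:
  "summable (\<lambda>k. (matrix_pow A k $ i $ j / fact k) * t ^ k)"
proof -
  obtain c where c: "\<And>k i j. norm (matrix_pow A k $ i $ j) \<le> c ^ k"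
    using matrix_pow_entry_bound[of A] by blast
  show ?thesis
  proof (rule summable_comparison_test')
    show "summable (\<lambda>k. (c * norm t) ^ k /\<^sub>R fact k)"
      by (rule summable_exp_generic)
    show "norm (matrix_pow A k $ i $ j / fact k * t ^ k) \<le> (c * norm t) ^ k /\<^sub>R fact k"
      for k
      using mult_left_mono[OF c[of k i j], of "norm t ^ k"]
      by (simp add: norm_mult norm_divide norm_power power_mult_distrib field_simps)
  qed
qed

lemma matrix_exp_entry:
  "matrix_exp (mat t ** A) $ i $ j = (\<Sum>k. (matrix_pow A k $ i $ j / fact k) * t ^ k)"
proof -
  define E where "E = (\<chi> i j. \<Sum>k. (matrix_pow A k $ i $ j / fact k) * t ^ k)"
  have "(\<lambda>k. matrix_pow (mat t ** A) k /\<^sub>R fact k) sums E"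
    unfolding sums_def
  proof (intro vec_tendstoI)
    fix i j
    have "(\<lambda>k. (matrix_pow A k $ i $ j / fact k) * t ^ k) sums (E $ i $ j)"
      unfolding E_def using summable_sums[OF summable_matrix_exp_entry] by simp
    moreover have "(matrix_pow (mat t ** A) k /\<^sub>R fact k) $ i $ j
        = (matrix_pow A k $ i $ j / fact k) * t ^ k" for k
      by (simp add: matrix_pow_scalar_mult scaleR_conv_of_real[where 'a = complex] field_simps)
    ultimately show "(\<lambda>n. (\<Sum>k<n. matrix_pow (mat t ** A) k /\<^sub>R fact k) $ i $ j) \<longlonglongrightarrow> E $ i $ j"
      unfolding sums_def sum_component by simp
  qed
  then have "matrix_exp (mat t ** A) = E"
    unfolding matrix_exp_def by (rule sums_unique[symmetric])
  then show ?thesis by (simp add: E_def)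
qed

lemma matrix_exp_entry_deriv:
  fixes A :: "complex ^ 'n ^ 'n"
  shows "((\<lambda>t. matrix_exp (mat t ** A) $ i $ j) has_field_derivative
     (A ** matrix_exp (mat t ** A)) $ i $ j) (at t)"
proof -
  have coeff: "diffs (\<lambda>k. matrix_pow A k $ i $ j / fact k) k * t ^ k
      = (\<Sum>l\<in>UNIV. A $ i $ l * ((matrix_pow A k $ l $ j / fact k) * t ^ k))" for k
    by (simp add: diffs_def matrix_matrix_mult_def sum_distrib_left sum_distrib_right
        sum_divide_distrib mult.assoc flip: of_nat_Suc)
  have "((\<lambda>t. \<Sum>k. (matrix_pow A k $ i $ j / fact k) * t ^ k) has_field_derivative
      (\<Sum>k. diffs (\<lambda>k. matrix_pow A k $ i $ j / fact k) k * t ^ k)) (at t)"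
    by (intro termdiffs_strong_converges_everywhere summable_matrix_exp_entry)
  also have "(\<Sum>k. diffs (\<lambda>k. matrix_pow A k $ i $ j / fact k) k * t ^ k)
      = (\<Sum>l\<in>UNIV. \<Sum>k. A $ i $ l * ((matrix_pow A k $ l $ j / fact k) * t ^ k))"
    unfolding coeff by (intro suminf_sum summable_mult summable_matrix_exp_entry)
  also have "\<dots> = (\<Sum>l\<in>UNIV. A $ i $ l * (\<Sum>k. (matrix_pow A k $ l $ j / fact k) * t ^ k))"
    by (intro sum.cong refl suminf_mult summable_matrix_exp_entry)
  also have "\<dots> = (A ** matrix_exp (mat t ** A)) $ i $ j"
    unfolding matrix_matrix_mult_def[of A] by (simp add: matrix_exp_entry)
  finally show ?thesis by (simp add: matrix_exp_entry)
qed

lemma complex_flow_linear_flow: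
  fixes A :: "complex ^ 'n ^ 'n"
  shows "complex_flow (\<lambda>w. A *v w) (linear_flow A)"
  unfolding complex_flow_def
proof (intro conjI allI)
  fix w
  have "(\<Sum>k. (matrix_pow A k $ i $ j / fact k) * 0 ^ k) = (mat 1 :: complex ^ 'n ^ 'n) $ i $ j" for i j
    using powser_zero[of "\<lambda>k. matrix_pow A k $ i $ j / fact k"] by simp
  then have "matrix_exp (mat 0 ** A) = mat 1"
    unfolding vec_eq_iff matrix_exp_entry by simp
  then show "linear_flow A 0 w = w"
    by (simp add: linear_flow_def)
  fix t
  show "((\<lambda>s. linear_flow A s w) has_derivative (\<lambda>h. h *s (A *v linear_flow A t w))) (at t)"
  proof (rule has_derivative_vecI)
    fix i
    have "((\<lambda>s. \<Sum>j\<in>UNIV. matrix_exp (mat s ** A) $ i $ j * w $ j) has_field_derivative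
        (\<Sum>j\<in>UNIV. (A ** matrix_exp (mat t ** A)) $ i $ j * w $ j)) (at t)"
      by (intro DERIV_sum DERIV_cmult_right matrix_exp_entry_deriv)
    then have "((\<lambda>s. linear_flow A s w $ i) has_field_derivative (A *v linear_flow A t w) $ i) (at t)"
      by (simp add: linear_flow_def matrix_vector_mul_assoc) (simp add: matrix_vector_mult_def)
    then show "((\<lambda>s. linear_flow A s w $ i) has_derivative
        (\<lambda>h. (h *s (A *v linear_flow A t w)) $ i)) (at t)"
      by (simp add: has_field_derivative_def mult_commute_abs)
  qed
qed

lemma linear_flow_add: "linear_flow A (s + t) w = linear_flow A s (linear_flow A t w)"
  by (rule complex_flow_add[OF holomorphic_map_matrix_vector_mult complex_flow_linear_flow])

section \<open>The intertwining relation\<close>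

lemma linearization_intertwines_real:
  fixes X :: "complex \<Rightarrow> complex ^ 'n \<Rightarrow> complex ^ 'n" and t :: real
  assumes X_add: "\<And>s t z. X (s + t) z = X s (X t z)"
    and F_lim: "\<And>z. ((\<lambda>t::real. linear_flow A (- of_real t) (X (of_real t) z)) \<longlongrightarrow> F z) at_top"
  shows "F (X (of_real t) z) = linear_flow A (of_real t) (F z)"
proof -
  have "filterlim (\<lambda>s::real. s + t) at_top at_top"
    using filterlim_tendsto_add_at_top[OF tendsto_const[of t] filterlim_ident]
    by (simp add: add.commute)
  then have "((\<lambda>s. linear_flow A (- of_real (s + t)) (X (of_real (s + t)) z)) \<longlongrightarrow> F z) at_top"
    by (rule filterlim_compose[OF F_lim])
  then have "((\<lambda>s. linear_flow A (of_real t) (linear_flow A (- of_real (s + t)) (X (of_real (s + t)) z)))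
      \<longlongrightarrow> linear_flow A (of_real t) (F z)) at_top"
    unfolding linear_flow_def[of A "of_real t"]
    by (rule bounded_linear.tendsto[OF matrix_vector_mul_bounded_linear])
  moreover have "linear_flow A (of_real t) (linear_flow A (- of_real (s + t)) (X (of_real (s + t)) z))
      = linear_flow A (- of_real s) (X (of_real s) (X (of_real t) z))" for s
    by (simp flip: linear_flow_add X_add)
  ultimately have "((\<lambda>s. linear_flow A (- of_real s) (X (of_real s) (X (of_real t) z)))
      \<longlongrightarrow> linear_flow A (of_real t) (F z)) at_top"
    by simp
  then show ?thesis
    using tendsto_unique[OF trivial_limit_at_top_linorder F_lim] by blast
qed

text \<open>
  The relation passes from real to complex time because \<open>F\<close> is holomorphic: its infinitesimal form
  \<open>DF(z) V(z) = A F(z)\<close> only involves real times near \<open>0\<close>.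
\<close>

lemma intertwines_complex_if_real:
  fixes X :: "complex \<Rightarrow> complex ^ 'n \<Rightarrow> complex ^ 'n"
  assumes X: "complex_flow V X" and F: "holomorphic_map F"
    and real: "\<And>(t::real) z. F (X (of_real t) z) = linear_flow A (of_real t) (F z)"
  shows "F (X t z) = linear_flow A t (F z)"
proof -
  have X0: "X 0 z = z" for z
    using X by (simp add: complex_flow_def)
  have L0: "linear_flow A 0 w = w" for w
    using complex_flow_linear_flow[of A] by (simp add: complex_flow_def)
  obtain M where M: "\<And>z. (F has_derivative (\<lambda>h. M z *v h)) (at z)"
    using F unfolding holomorphic_map_def by metis
  have infinitesimal: "M z *v V z = A *v F z" for z
  proof (rule vector_derivative_unique_at)
    have "((\<lambda>u::real. X (of_real u) z) has_vector_derivative V z) (at 0)"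
      using complex_trajectory_ray[OF complex_flow_trajectory[OF X],
          where c = 1 and u = 0 and z1 = z]
      by (simp add: X0)
    from has_derivative_compose[OF this[unfolded has_vector_derivative_def] M]
    show "((\<lambda>u::real. F (X (of_real u) z)) has_vector_derivative M z *v V z) (at 0)"
      by (simp add: has_vector_derivative_def X0
          linear_scale[OF bounded_linear.linear[OF matrix_vector_mul_bounded_linear]])
    have "((\<lambda>u::real. linear_flow A (of_real u) (F z)) has_vector_derivative A *v F z) (at 0)"
      using complex_trajectory_ray[OF complex_flow_trajectory[OF complex_flow_linear_flow[of A]],
          where c = 1 and u = 0 and z1 = "F z"]
      by (simp add: L0)
    then show "((\<lambda>u::real. F (X (of_real u) z)) has_vector_derivative A *v F z) (at 0)"
      by (simp add: real)
  qed
  show ?thesis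
  proof (rule complex_trajectory_unique[OF holomorphic_map_matrix_vector_mult,
        where x = "\<lambda>t. F (X t z)" and y = "\<lambda>t. linear_flow A t (F z)"])
    show "complex_trajectory (\<lambda>w. A *v w) (\<lambda>t. F (X t z))"
      unfolding complex_trajectory_def
    proof
      fix t
      have "((\<lambda>s. X s z) has_derivative (\<lambda>h. h *s V (X t z))) (at t)"
        using X by (simp add: complex_flow_def)
      from has_derivative_compose[OF this M]
      show "((\<lambda>s. F (X s z)) has_derivative (\<lambda>h. h *s (A *v F (X t z)))) (at t)"
        by (simp add: vector_scalar_commute infinitesimal)
    qed
    show "complex_trajectory (\<lambda>w. A *v w) (\<lambda>t. linear_flow A t (F z))"
      by (rule complex_flow_trajectory[OF complex_flow_linear_flow])
    show "F (X 0 z) = linear_flow A 0 (F z)"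
      by (simp add: X0 L0)
  qed
qed

lemma is_domain_vimage:
  assumes F: "holomorphic_automorphism F" and D: "is_domain D"
  shows "is_domain (F -` D)"
proof -
  have bij: "bij F" and cont: "\<And>S. continuous_on S F" "\<And>S. continuous_on S (inv F)"
    using F holomorphic_map_continuous_on unfolding holomorphic_automorphism_def by blast+
  have img: "F -` D = inv F ` D"
    using bij by (rule bij_vimage_eq_inv_image)
  show ?thesis
    unfolding is_domain_def
  proof (intro conjI)
    show "open (F -` D)"
      using D cont(1)[of UNIV] by (simp add: is_domain_def open_vimage)
    show "connected (F -` D)" "F -` D \<noteq> {}"
      using D cont(2) by (auto simp: img is_domain_def intro: connected_continuous_image)
  qed
qed

theorem corollary1p9:
  fixes V R F :: "complex ^ 'n \<Rightarrow> complex ^ 'n"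
    and X :: "complex \<Rightarrow> complex ^ 'n \<Rightarrow> complex ^ 'n"
    and A :: "complex ^ 'n ^ 'n"
  assumes V_holomorphic: "holomorphic_map V"
    and X_flow: "complex_flow V X"
    and attracting: "globally_attracting_origin V X"
    and A_eq: "(V has_derivative (\<lambda>h. A *v h)) (at 0)"
    and V_eq: "\<And>z. V z = A *v z + R z"
    and R_small: "((\<lambda>z. R z /\<^sub>R norm z) \<longlongrightarrow> 0) (at 0)"
    and integral_conv: "\<And>K. compact K \<Longrightarrow>
          uniformly_convergent_improper_integral K
            (\<lambda>s z. linear_flow A (- of_real s) (R (X (of_real s) z)))"
    and F_aut: "holomorphic_automorphism F"
    and F_lim: "\<And>z. ((\<lambda>t::real. linear_flow A (- of_real t) (X (of_real t) z)) \<longlongrightarrow> F z) at_top"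
  shows "(\<forall>D. positive_time_invariant (linear_flow A) D \<longrightarrow>
              positive_time_invariant X (F -` D) \<and> (is_domain D \<longrightarrow> is_domain (F -` D)))
       \<and> (\<forall>J :: complex ^ 'n \<Rightarrow> 'b.
            (first_integral UNIV (linear_flow A) J \<longrightarrow> first_integral UNIV X (J \<circ> F)) \<and>
            (first_integral \<real> (linear_flow A) J \<longrightarrow> first_integral \<real> X (J \<circ> F)))"
proof -
  have real: "F (X (of_real t) z) = linear_flow A (of_real t) (F z)" for t :: real and z
    using complex_flow_add[OF V_holomorphic X_flow] F_lim by (rule linearization_intertwines_real)
  have F: "holomorphic_map F"
    using F_aut by (simp add: holomorphic_automorphism_def)
  have "F (X t z) = linear_flow A t (F z)" for t z
    by (rule intertwines_complex_if_real[OF X_flow F real])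
  then show ?thesis
    using is_domain_vimage[OF F_aut]
    by (auto simp: positive_time_invariant_def first_integral_def image_subset_iff)
qed

end
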